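(* For every instance of problem FM (with $t^*>0$) and every $LD_0$ schedule of it with makespan $t_{LD_0}$, one has $1\le t_{LD_0}/t^*\le 4/3$. Moreover, for every $m\ge 3$ there is an instance on $m$ machines with an $LD_0$ schedule attaining $t_{LD_0}/t^*=4/3$.
   Context: Problem FM: there are $m\ge 1$ identical parallel machines and $n=mk$ jobs ($k\ge 1$ is the number of ranks; an instance with fewer jobs is padded with jobs of processing time $0$), with nonnegative real processing times indexed so that $p_1\ge p_2\ge\cdots\ge p_n$. For $r\in\{1,\dots,k\}$, rank $r$ is the set of jobs $(r-1)m+1,\dots,rm$. A flowtime-optimal schedule assigns to every machine exactly one job from each rank and processes the jobs on each machine consecutively from time $0$ without idle time, in the order rank $k$, rank $k-1$, \dots, rank $1$; its makespan is the largest machine completion time. $t^*$ denotes the minimum makespan over all flowtime-optimal schedules. An $LD_0$ schedule is a flowtime-optimal schedule constructed as follows: the jobs of rank $1$ are assigned to the machines arbitrarily (one per machine); the jobs of rank $2$ are assigned largest-first, i.e. in nonincreasing order of processing time each to the earliest available machine (so the largest rank-2 job goes on the machine with the smallest rank-1 job, etc.); the jobs of each remaining rank are assigned arbitrarily (one per machine); finally the job order on each machine is reversed. *)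

theory Defs
  imports Complex_Main "HOL-Library.FuncSet"
begin

text \<open>
  Machines are \<open>1, \<dots>, m\<close> and jobs are \<open>1, \<dots>, m * k\<close>. Processing times are given by
  \<open>p\<close>, of which only the values on jobs matter. A schedule is identified with the map \<open>\<sigma>\<close>
  sending each job to its machine, since the start times are then determined by the
  prescribed processing order.
\<close>

definition machines :: "nat \<Rightarrow> nat set" where
  "machines m = {1..m}"

definition jobs :: "nat \<Rightarrow> nat \<Rightarrow> nat set" where
  "jobs m k = {1..m * k}"

definition rank_jobs :: "nat \<Rightarrow> nat \<Rightarrow> nat set" where
  "rank_jobs m r = {(r - 1) * m + 1..r * m}"

definition fm_instance :: "nat \<Rightarrow> nat \<Rightarrow> (nat \<Rightarrow> real) \<Rightarrow> bool" where
  "fm_instance m k p \<longleftrightarrow>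
     m \<ge> 1 \<and> k \<ge> 1 \<and>
     (\<forall>j\<in>jobs m k. p j \<ge> 0) \<and>
     (\<forall>i\<in>jobs m k. \<forall>j\<in>jobs m k. i \<le> j \<longrightarrow> p j \<le> p i)"

definition flowtime_optimal :: "nat \<Rightarrow> nat \<Rightarrow> (nat \<Rightarrow> nat) \<Rightarrow> bool" where
  "flowtime_optimal m k \<sigma> \<longleftrightarrow>
     \<sigma> \<in> jobs m k \<rightarrow>\<^sub>E machines m \<and>
     (\<forall>r\<in>{1..k}. bij_betw \<sigma> (rank_jobs m r) (machines m))"

definition machine_load :: "(nat \<Rightarrow> real) \<Rightarrow> (nat \<Rightarrow> nat) \<Rightarrow> nat set \<Rightarrow> nat \<Rightarrow> real" where
  "machine_load p \<sigma> J i = (\<Sum>j\<in>{j \<in> J. \<sigma> j = i}. p j)"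

text \<open>
  The ranks are processed in the order \<open>k, k - 1, \<dots>, 1\<close> without idle time, so the rank-\<open>r\<close>
  job on machine \<open>i\<close> completes once all jobs of ranks \<open>r, \<dots>, k\<close> on that machine are done.
\<close>

definition completion_time ::
  "nat \<Rightarrow> nat \<Rightarrow> (nat \<Rightarrow> real) \<Rightarrow> (nat \<Rightarrow> nat) \<Rightarrow> nat \<Rightarrow> nat \<Rightarrow> real" where
  "completion_time m k p \<sigma> i r = machine_load p \<sigma> (\<Union>s\<in>{r..k}. rank_jobs m s) i"

definition machine_completion ::
  "nat \<Rightarrow> nat \<Rightarrow> (nat \<Rightarrow> real) \<Rightarrow> (nat \<Rightarrow> nat) \<Rightarrow> nat \<Rightarrow> real" where
  "machine_completion m k p \<sigma> i = Max (completion_time m k p \<sigma> i ` {1..k})"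

definition makespan :: "nat \<Rightarrow> nat \<Rightarrow> (nat \<Rightarrow> real) \<Rightarrow> (nat \<Rightarrow> nat) \<Rightarrow> real" where
  "makespan m k p \<sigma> = Max (machine_completion m k p \<sigma> ` machines m)"

definition opt_makespan :: "nat \<Rightarrow> nat \<Rightarrow> (nat \<Rightarrow> real) \<Rightarrow> real" where
  "opt_makespan m k p = Min (makespan m k p ` {\<sigma>. flowtime_optimal m k \<sigma>})"

text \<open>
  In the construction phase rank 1 comes first. The list \<open>js\<close> is the order in which the jobs of
  rank 2 are assigned; its \<open>a\<close>-th entry goes to a machine that is earliest available among those
  that have not yet received a rank-2 job. Ties, both between jobs and between machines, may be
  broken in any way. The final reversal of the job order is accounted for in \<open>completion_time\<close>.
\<close>

definition LD0_schedule :: "nat \<Rightarrow> nat \<Rightarrow> (nat \<Rightarrow> real) \<Rightarrow> (nat \<Rightarrow> nat) \<Rightarrow> bool" where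
  "LD0_schedule m k p \<sigma> \<longleftrightarrow>
     flowtime_optimal m k \<sigma> \<and>
     (k \<ge> 2 \<longrightarrow>
       (\<exists>js. distinct js \<and> set js = rank_jobs m 2 \<and>
          sorted_wrt (\<lambda>i j. p i \<ge> p j) js \<and>
          (\<forall>a<length js.
             is_arg_min (machine_load p \<sigma> (rank_jobs m 1 \<union> set (take a js)))
               (\<lambda>i. i \<in> machines m - \<sigma> ` set (take a js)) (\<sigma> (js ! a)))))"

lemma finite_flowtime_optimal: "finite {\<sigma>. flowtime_optimal m k \<sigma>}"
proof -
  have "finite (jobs m k \<rightarrow>\<^sub>E machines m)"
    by (intro finite_PiE) (auto simp: jobs_def machines_def)
  then show ?thesis
    by (rule rev_finite_subset) (auto simp: flowtime_optimal_def)
qed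

lemma flowtime_optimal_exists:
  assumes "m \<ge> 1"
  shows "\<exists>\<sigma>. flowtime_optimal m k \<sigma>"
proof -
  define \<sigma> where "\<sigma> = restrict (\<lambda>j. (j - 1) mod m + 1) (jobs m k)"
  have "bij_betw \<sigma> (rank_jobs m r) (machines m)" if r: "r \<in> {1..k}" for r
  proof (rule bij_betw_byWitness[where f' = "\<lambda>i. (r - 1) * m + i"])
    obtain q where q: "r = Suc q" "Suc q \<le> k" using r by (cases r) auto
    have sub: "rank_jobs m r \<subseteq> jobs m k"
    proof -
      have "r * m \<le> m * k" using r by (simp add: mult.commute)
      then show ?thesis by (auto simp: rank_jobs_def jobs_def)
    qed
    have val: "\<sigma> (q * m + i) = i" if "i \<in> {1..m}" for i
    proof -
      have "q * m + i \<in> rank_jobs m r" using that q by (auto simp: rank_jobs_def)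
      then have "\<sigma> (q * m + i) = (q * m + i - 1) mod m + 1" using sub by (auto simp: \<sigma>_def)
      also have "q * m + i - 1 = q * m + (i - 1)" using that by auto
      also have "(q * m + (i - 1)) mod m = i - 1"
        unfolding mod_mult_self3 using that by (intro mod_less) auto
      finally show ?thesis using that by auto
    qed
    have ex: "\<exists>i\<in>{1..m}. j = q * m + i" if "j \<in> rank_jobs m r" for j
      using that q by (intro bexI[of _ "j - q * m"]) (auto simp: rank_jobs_def)
    show "\<forall>a\<in>rank_jobs m r. (r - 1) * m + \<sigma> a = a" using ex val q by fastforce
    show "\<forall>a'\<in>machines m. \<sigma> ((r - 1) * m + a') = a'"
      using val q by (auto simp: machines_def)
    show "\<sigma> ` rank_jobs m r \<subseteq> machines m" using ex val by (fastforce simp: machines_def)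
    show "(\<lambda>i. (r - 1) * m + i) ` machines m \<subseteq> rank_jobs m r"
      using q by (auto simp: machines_def rank_jobs_def)
  qed
  moreover have "\<sigma> \<in> jobs m k \<rightarrow>\<^sub>E machines m"
    using assms by (auto simp: \<sigma>_def machines_def Suc_le_eq)
  ultimately show ?thesis unfolding flowtime_optimal_def by blast
qed

end

theory Submission
  imports Defs
begin

text \<open>
  Write \<open>\<lambda>\<^sub>r\<close> and \<open>\<mu>\<^sub>r\<close> for the largest and smallest processing time of rank \<open>r\<close>, and \<open>b\<close> for the
  largest load that the LD0 schedule puts on a machine with ranks 1 and 2. Largest-first assignment
  of rank 2 minimises \<open>b\<close> over all flowtime-optimal schedules, so
  \<open>t* \<ge> b + \<mu>\<^sub>3 + \<dots> + \<mu>\<^sub>k\<close>, while the LD0 makespan is at most \<open>b + \<lambda>\<^sub>3 + \<dots> + \<lambda>\<^sub>k\<close>. As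
  \<open>\<lambda>\<^sub>r\<^sub>+\<^sub>1 \<le> \<mu>\<^sub>r\<close>, the difference telescopes to at most \<open>\<lambda>\<^sub>3\<close>. Finally \<open>3 \<lambda>\<^sub>3 \<le> t*\<close>, because the
  machine that processes the largest rank-3 job also processes a job of rank 1 and one of rank 2.
\<close>

section \<open>Ranks and the loads they put on machines\<close>

lemma rank_jobs_subset_jobs:
  assumes "r \<in> {1..k}"
  shows "rank_jobs m r \<subseteq> jobs m k"
proof -
  have "r * m \<le> m * k" using assms by (simp add: mult.commute)
  then show ?thesis by (auto simp: rank_jobs_def jobs_def)
qed

lemma rank_jobs_less:
  assumes "i \<in> rank_jobs m r" "j \<in> rank_jobs m s" "r < s"
  shows "i < j"
proof -
  have "r * m \<le> (s - 1) * m" using assms by (intro mult_right_mono) auto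
  moreover have "i \<le> r * m" "(s - 1) * m + 1 \<le> j"
    using assms(1,2) by (auto simp: rank_jobs_def)
  ultimately show ?thesis by linarith
qed

lemma rank_jobs_first:
  assumes "1 \<le> m" "1 \<le> r"
  shows "(r - 1) * m + 1 \<in> rank_jobs m r"
  using assms by (cases r) (auto simp: rank_jobs_def)

lemma rank_jobs_last:
  assumes "1 \<le> m" "1 \<le> r"
  shows "r * m \<in> rank_jobs m r"
  using assms by (cases r) (auto simp: rank_jobs_def)

lemma card_rank_jobs: "1 \<le> r \<Longrightarrow> card (rank_jobs m r) = m"
  by (cases r) (auto simp: rank_jobs_def)

lemma processing_time_antimono:
  assumes "fm_instance m k p" "i \<in> jobs m k" "j \<in> jobs m k" "i \<le> j"
  shows "p j \<le> p i"
  using assms by (auto simp: fm_instance_def)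

lemma processing_time_rank_antimono:
  assumes inst: "fm_instance m k p"
    and "i \<in> rank_jobs m r" "j \<in> rank_jobs m s" "1 \<le> r" "r < s" "s \<le> k"
  shows "p j \<le> p i"
proof -
  have "i \<in> jobs m k" "j \<in> jobs m k"
    using rank_jobs_subset_jobs[of r k m] rank_jobs_subset_jobs[of s k m] assms by auto
  moreover have "i \<le> j" using rank_jobs_less assms by (meson less_imp_le)
  ultimately show ?thesis using processing_time_antimono[OF inst] by blast
qed

lemma machine_load_rank_job:
  assumes "flowtime_optimal m k \<sigma>" "r \<in> {1..k}" "j \<in> rank_jobs m r"
  shows "machine_load p \<sigma> (rank_jobs m r) (\<sigma> j) = p j"
proof -
  have "inj_on \<sigma> (rank_jobs m r)"
    using assms by (auto simp: flowtime_optimal_def bij_betw_def)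
  then have "{j' \<in> rank_jobs m r. \<sigma> j' = \<sigma> j} = {j}"
    using assms(3) by (auto dest: inj_onD)
  then show ?thesis by (simp add: machine_load_def)
qed

lemma rank_job_on_machine:
  assumes "flowtime_optimal m k \<sigma>" "r \<in> {1..k}" "i \<in> machines m"
  obtains j where "j \<in> rank_jobs m r" "\<sigma> j = i" "machine_load p \<sigma> (rank_jobs m r) i = p j"
proof -
  have "i \<in> \<sigma> ` rank_jobs m r"
    using assms by (auto simp: flowtime_optimal_def bij_betw_def)
  then show ?thesis using machine_load_rank_job[OF assms(1,2)] that by auto
qed

text \<open>As \<open>p\<close> is nonincreasing, the largest job of a rank is its first,
  \<open>(r - 1) * m + 1\<close>, and the smallest its last, \<open>r * m\<close>. So the two bounds
  are the quantities written \<lambda> and \<mu> in the overview.\<close>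

lemma machine_load_rank_bounds:
  assumes inst: "fm_instance m k p" and \<sigma>: "flowtime_optimal m k \<sigma>"
    and r: "r \<in> {1..k}" and i: "i \<in> machines m"
  shows "p (r * m) \<le> machine_load p \<sigma> (rank_jobs m r) i"
    and "machine_load p \<sigma> (rank_jobs m r) i \<le> p ((r - 1) * m + 1)"
    and "0 \<le> machine_load p \<sigma> (rank_jobs m r) i"
proof -
  obtain j where j: "j \<in> rank_jobs m r" "machine_load p \<sigma> (rank_jobs m r) i = p j"
    using rank_job_on_machine[OF \<sigma> r i] by metis
  have m: "1 \<le> m" using inst by (auto simp: fm_instance_def)
  note sub = subsetD[OF rank_jobs_subset_jobs[OF r, of m]]
  have "(r - 1) * m + 1 \<in> rank_jobs m r" "r * m \<in> rank_jobs m r"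
    using rank_jobs_first[OF m] rank_jobs_last[OF m] r by auto
  moreover have "(r - 1) * m + 1 \<le> j" "j \<le> r * m"
    using j by (auto simp: rank_jobs_def)
  ultimately show "p (r * m) \<le> machine_load p \<sigma> (rank_jobs m r) i"
    "machine_load p \<sigma> (rank_jobs m r) i \<le> p ((r - 1) * m + 1)"
    "0 \<le> machine_load p \<sigma> (rank_jobs m r) i"
    using j sub processing_time_antimono[OF inst] inst by (auto simp: fm_instance_def)
qed

section \<open>Makespans as sums of rank loads\<close>

lemma completion_time_eq_sum:
  "completion_time m k p \<sigma> i r = (\<Sum>s\<in>{r..k}. machine_load p \<sigma> (rank_jobs m s) i)"
proof -
  have "{j \<in> \<Union>s\<in>{r..k}. rank_jobs m s. \<sigma> j = i} = (\<Union>s\<in>{r..k}. {j \<in> rank_jobs m s. \<sigma> j = i})"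
    by auto
  moreover have "rank_jobs m s \<inter> rank_jobs m s' = {}" if "s \<noteq> s'" for s s'
    using that rank_jobs_less by (metis disjoint_iff less_irrefl nat_neq_iff)
  then have "\<forall>s\<in>{r..k}. \<forall>s'\<in>{r..k}. s \<noteq> s' \<longrightarrow>
      {j \<in> rank_jobs m s. \<sigma> j = i} \<inter> {j \<in> rank_jobs m s'. \<sigma> j = i} = {}"
    by blast
  ultimately show ?thesis
    unfolding completion_time_def machine_load_def
    by (simp add: sum.UNION_disjoint rank_jobs_def)
qed

text \<open>Rank 1 is processed last and loads are nonnegative, so the maximum over the ranks is
  attained at rank 1.\<close>

lemma machine_completion_eq_sum:
  assumes inst: "fm_instance m k p" and \<sigma>: "flowtime_optimal m k \<sigma>" and i: "i \<in> machines m"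
  shows "machine_completion m k p \<sigma> i = (\<Sum>r\<in>{1..k}. machine_load p \<sigma> (rank_jobs m r) i)"
proof -
  have "completion_time m k p \<sigma> i r \<le> completion_time m k p \<sigma> i 1" if "r \<in> {1..k}" for r
    unfolding completion_time_eq_sum using that machine_load_rank_bounds(3)[OF inst \<sigma> _ i]
    by (intro sum_mono2) auto
  moreover have "1 \<in> {1..k}" using inst by (auto simp: fm_instance_def)
  ultimately have "machine_completion m k p \<sigma> i = completion_time m k p \<sigma> i 1"
    unfolding machine_completion_def by (intro Max_eqI) auto
  then show ?thesis by (simp add: completion_time_eq_sum)
qed

lemma sum_loads_le_makespan:
  assumes "fm_instance m k p" "flowtime_optimal m k \<sigma>" "i \<in> machines m"
  shows "(\<Sum>r\<in>{1..k}. machine_load p \<sigma> (rank_jobs m r) i) \<le> makespan m k p \<sigma>"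
  unfolding makespan_def machine_completion_eq_sum[OF assms, symmetric]
  using assms(3) by (intro Max_ge) (auto simp: machines_def)

lemma makespan_attained:
  assumes inst: "fm_instance m k p" and \<sigma>: "flowtime_optimal m k \<sigma>"
  obtains i where "i \<in> machines m"
    "makespan m k p \<sigma> = (\<Sum>r\<in>{1..k}. machine_load p \<sigma> (rank_jobs m r) i)"
proof -
  have "machines m \<noteq> {}" "finite (machines m)"
    using inst by (auto simp: fm_instance_def machines_def)
  then have "makespan m k p \<sigma> \<in> machine_completion m k p \<sigma> ` machines m"
    unfolding makespan_def by (intro Max_in) auto
  then show ?thesis using machine_completion_eq_sum[OF inst \<sigma>] that by auto
qed

lemma opt_makespan_le:
  "flowtime_optimal m k \<sigma> \<Longrightarrow> opt_makespan m k p \<le> makespan m k p \<sigma>"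
  unfolding opt_makespan_def by (intro Min_le) (auto simp: finite_flowtime_optimal)

lemma opt_makespan_attained:
  assumes "1 \<le> m"
  obtains \<tau> where "flowtime_optimal m k \<tau>" "opt_makespan m k p = makespan m k p \<tau>"
proof -
  have "opt_makespan m k p \<in> makespan m k p ` {\<sigma>. flowtime_optimal m k \<sigma>}"
    unfolding opt_makespan_def using flowtime_optimal_exists[OF assms]
    by (intro Min_in) (auto simp: finite_flowtime_optimal)
  then show ?thesis using that by auto
qed

section \<open>The upper bound 4/3\<close>

text \<open>
  Suppose the LD0 schedule gives the \<open>a\<close>-th largest rank-2 job (counting from 0) to a machine with
  rank-1 load \<open>x\<close>. Then there are \<open>a + 1\<close> rank-2 jobs at least that large, and the \<open>m - a\<close> machines
  still available carry rank-1 jobs of size at least \<open>x\<close>; by pigeonhole every flowtime-optimal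
  schedule combines two of these jobs.
\<close>

lemma LD0_first_two_ranks_optimal:
  assumes ld: "LD0_schedule m k p \<sigma>" and k: "2 \<le> k" and \<tau>: "flowtime_optimal m k \<tau>"
    and i: "i \<in> machines m"
  obtains i' where "i' \<in> machines m"
    "machine_load p \<sigma> (rank_jobs m 1) i + machine_load p \<sigma> (rank_jobs m 2) i
      \<le> machine_load p \<tau> (rank_jobs m 1) i' + machine_load p \<tau> (rank_jobs m 2) i'"
proof -
  have \<sigma>: "flowtime_optimal m k \<sigma>" using ld by (simp add: LD0_schedule_def)
  have r1: "1 \<in> {1..k}" and r2: "2 \<in> {1..k}" using k by auto
  obtain js where js: "distinct js" "set js = rank_jobs m 2" "sorted_wrt (\<lambda>i j. p i \<ge> p j) js"
    and greedy: "\<And>a. a < length js \<Longrightarrow>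
       is_arg_min (machine_load p \<sigma> (rank_jobs m 1 \<union> set (take a js)))
         (\<lambda>i. i \<in> machines m - \<sigma> ` set (take a js)) (\<sigma> (js ! a))"
    using ld k by (auto simp: LD0_schedule_def)
  have len: "length js = m"
    using distinct_card[OF js(1)] js(2) by (simp add: card_rank_jobs)
  obtain x where x: "x \<in> rank_jobs m 1" "\<sigma> x = i" "machine_load p \<sigma> (rank_jobs m 1) i = p x"
    using rank_job_on_machine[OF \<sigma> r1 i] by metis
  obtain y where y: "y \<in> rank_jobs m 2" "\<sigma> y = i" "machine_load p \<sigma> (rank_jobs m 2) i = p y"
    using rank_job_on_machine[OF \<sigma> r2 i] by metis
  obtain a where a: "a < m" "js ! a = y"
    using y(1) js(2) len by (metis in_set_conv_nth)
  \<comment> \<open>\<open>S\<close> and \<open>X\<close> are the two job sets of the pigeonhole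
    argument: \<open>y\<close> with the rank-2 jobs assigned before it, and the rank-1 jobs on the
    machines \<open>F\<close> still available when \<open>y\<close> is assigned.\<close>
  define S where "S = set (take (Suc a) js)"
  define F where "F = machines m - \<sigma> ` set (take a js)"
  define X where "X = {j \<in> rank_jobs m 1. \<sigma> j \<in> F}"
  have bij: "bij_betw \<sigma> (rank_jobs m r) (machines m)" "bij_betw \<tau> (rank_jobs m r) (machines m)"
    if "r \<in> {1..k}" for r
    using \<sigma> \<tau> that by (auto simp: flowtime_optimal_def)
  have S_sub: "S \<subseteq> rank_jobs m 2"
    using js(2) set_take_subset unfolding S_def by fast
  have take_sub: "set (take a js) \<subseteq> rank_jobs m 2"
    using js(2) set_take_subset by fast
  have cardS: "card S = Suc a"
    unfolding S_def using js(1) len a by (subst distinct_card) auto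
  have card_take: "card (set (take a js)) = a"
    using js(1) len a by (subst distinct_card) auto
  have "card (\<sigma> ` set (take a js)) = a"
    using card_take card_image inj_on_subset[OF bij_betw_imp_inj_on[OF bij(1)[OF r2]] take_sub]
    by metis
  moreover have "\<sigma> ` set (take a js) \<subseteq> machines m"
    using take_sub bij(1)[OF r2] by (auto simp: bij_betw_def)
  ultimately have cardF: "card F = m - a"
    unfolding F_def by (subst card_Diff_subset) (auto simp: machines_def)
  have X_sub: "X \<subseteq> rank_jobs m 1" by (auto simp: X_def)
  have "F \<subseteq> \<sigma> ` rank_jobs m 1"
    using bij_betw_imp_surj_on[OF bij(1)[OF r1]] by (auto simp: F_def)
  then have "\<sigma> ` X = F" by (auto simp: X_def)
  moreover have "inj_on \<sigma> X"
    using inj_on_subset[OF bij_betw_imp_inj_on[OF bij(1)[OF r1]] X_sub] .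
  ultimately have cardX: "card X = m - a"
    using cardF card_image by metis
  have "card (\<tau> ` S) = Suc a"
    using cardS card_image inj_on_subset[OF bij_betw_imp_inj_on[OF bij(2)[OF r2]] S_sub] by metis
  moreover have "card (\<tau> ` X) = m - a"
    using cardX card_image inj_on_subset[OF bij_betw_imp_inj_on[OF bij(2)[OF r1]] X_sub] by metis
  moreover have "\<tau> ` S \<union> \<tau> ` X \<subseteq> machines m"
    using S_sub X_sub bij_betwE[OF bij(2)[OF r1]] bij_betwE[OF bij(2)[OF r2]] by auto
  then have "card (\<tau> ` S \<union> \<tau> ` X) \<le> m"
    using card_mono[of "machines m"] by (fastforce simp: machines_def)
  moreover have "finite (\<tau> ` S)" "finite (\<tau> ` X)"
    by (auto simp: S_def X_def rank_jobs_def)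
  \<comment> \<open>The two images have \<open>Suc a\<close> and \<open>m - a\<close> elements, one
    too many to be disjoint among \<open>m\<close> machines.\<close>
  ultimately have "\<tau> ` S \<inter> \<tau> ` X \<noteq> {}"
    using card_Un_disjoint[of "\<tau> ` S" "\<tau> ` X"] a by auto
  then obtain s z where sz: "s \<in> S" "z \<in> X" "\<tau> s = \<tau> z" by auto
  have "p y \<le> p s"
  proof -
    obtain b where b: "b \<le> a" "s = js ! b"
      using sz(1) len a by (auto simp: S_def in_set_conv_nth less_Suc_eq_le)
    show ?thesis
      using sorted_wrt_nth_less[OF js(3), of b a] b a len by (cases "b = a") auto
  qed
  moreover have "p x \<le> p z"
  proof -
    \<comment> \<open>No job of \<open>take a js\<close> lies on a machine of \<open>F\<close>, so
      there the greedy rule compares rank-1 loads only.\<close>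
    have free: "machine_load p \<sigma> (rank_jobs m 1 \<union> set (take a js)) i'
        = machine_load p \<sigma> (rank_jobs m 1) i'" if "i' \<in> F" for i'
      unfolding machine_load_def using that by (intro sum.cong) (auto simp: F_def)
    have iF: "i \<in> F" and zF: "\<sigma> z \<in> F"
      using greedy[of a] a len y sz by (auto simp: is_arg_min_def F_def X_def)
    have "\<not> machine_load p \<sigma> (rank_jobs m 1) (\<sigma> z) < machine_load p \<sigma> (rank_jobs m 1) i"
      using greedy[of a] a len y(2) zF free[OF zF] free[OF iF]
      unfolding is_arg_min_def F_def by metis
    moreover have "machine_load p \<sigma> (rank_jobs m 1) (\<sigma> z) = p z"
      using machine_load_rank_job[OF \<sigma> r1] sz by (auto simp: X_def)
    ultimately show ?thesis using x by simp
  qed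
  moreover have "machine_load p \<tau> (rank_jobs m 1) (\<tau> s) = p z"
    using machine_load_rank_job[OF \<tau> r1, of z] sz by (auto simp: X_def)
  moreover have "machine_load p \<tau> (rank_jobs m 2) (\<tau> s) = p s"
    using machine_load_rank_job[OF \<tau> r2, of s] sz S_sub by auto
  moreover have "\<tau> s \<in> machines m"
    using sz S_sub bij_betwE[OF bij(2)[OF r2]] by blast
  ultimately show ?thesis using that[of "\<tau> s"] x y by auto
qed

text \<open>The telescoping estimate, written without subtraction. The smallest job
  \<open>p (n * m)\<close> of the last rank is kept on the left because the induction step needs it
  to dominate the largest job of rank \<open>Suc n\<close>.\<close>

lemma sum_first_le_sum_last:
  assumes inst: "fm_instance m k p" and "1 \<le> q" "q \<le> n" "n \<le> k"
  shows "(\<Sum>r\<in>{q..n}. p ((r - 1) * m + 1)) + p (n * m)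
      \<le> (\<Sum>r\<in>{q..n}. p (r * m)) + p ((q - 1) * m + 1)"
  using \<open>q \<le> n\<close> \<open>n \<le> k\<close>
proof (induction n rule: dec_induct)
  case base
  then show ?case by simp
next
  case (step n)
  have m: "1 \<le> m" using inst by (auto simp: fm_instance_def)
  have "p ((Suc n - 1) * m + 1) \<le> p (n * m)"
    using rank_jobs_first[OF m, of "Suc n"] rank_jobs_last[OF m, of n] step.hyps step.prems assms
    by (intro processing_time_rank_antimono[OF inst, of _ n _ "Suc n"]) auto
  then show ?case using step by simp
qed

lemma three_times_rank3_le_makespan:
  assumes inst: "fm_instance m k p" and \<tau>: "flowtime_optimal m k \<tau>" and k: "3 \<le> k"
  shows "3 * p (2 * m + 1) \<le> makespan m k p \<tau>"
proof -
  let ?L = "\<lambda>r. machine_load p \<tau> (rank_jobs m r) (\<tau> (2 * m + 1))"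
  have m: "1 \<le> m" using inst by (auto simp: fm_instance_def)
  have j3: "2 * m + 1 \<in> rank_jobs m 3" using rank_jobs_first[OF m, of 3] by simp
  have i: "\<tau> (2 * m + 1) \<in> machines m"
    using \<tau> j3 k bij_betwE[of \<tau> "rank_jobs m 3" "machines m"]
    by (auto simp: flowtime_optimal_def)
  have "p (2 * m + 1) \<le> ?L r" if r: "r \<in> {1..3}" for r
  proof (cases "r = 3")
    case True
    then show ?thesis using machine_load_rank_job[OF \<tau> _ j3] k by simp
  next
    case False
    have "r \<in> {1..k}" using r k by auto
    then obtain j where j: "j \<in> rank_jobs m r" "?L r = p j"
      using rank_job_on_machine[OF \<tau> _ i] by metis
    then show ?thesis
      using processing_time_rank_antimono[OF inst j(1) j3] r False k by auto
  qed
  then have "(\<Sum>r\<in>{1..3::nat}. p (2 * m + 1)) \<le> (\<Sum>r\<in>{1..3}. ?L r)" by (intro sum_mono)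
  also have "\<dots> \<le> (\<Sum>r\<in>{1..k}. ?L r)"
    using k machine_load_rank_bounds(3)[OF inst \<tau> _ i] by (intro sum_mono2) auto
  also have "\<dots> \<le> makespan m k p \<tau>" by (rule sum_loads_le_makespan[OF inst \<tau> i])
  finally show ?thesis by simp
qed

text \<open>Comparing with an arbitrary \<tau> gives the ratio bound when \<tau> is optimal. The
  tight instance uses the same inequality backwards, as a lower bound on the optimum.\<close>

lemma LD0_makespan_bound:
  assumes inst: "fm_instance m k p" and ld: "LD0_schedule m k p \<sigma>"
    and \<tau>: "flowtime_optimal m k \<tau>"
  shows "3 * makespan m k p \<sigma> \<le> 4 * makespan m k p \<tau>"
proof -
  let ?L = "\<lambda>\<rho> r i. machine_load p \<rho> (rank_jobs m r) i"
  have \<sigma>: "flowtime_optimal m k \<sigma>" using ld by (simp add: LD0_schedule_def)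
  have k: "1 \<le> k" using inst by (auto simp: fm_instance_def)
  obtain i where i: "i \<in> machines m" "makespan m k p \<sigma> = (\<Sum>r\<in>{1..k}. ?L \<sigma> r i)"
    by (rule makespan_attained[OF inst \<sigma>])
  have nonneg: "0 \<le> makespan m k p \<tau>"
    using sum_loads_le_makespan[OF inst \<tau> i(1)]
      sum_nonneg[of "{1..k}" "\<lambda>r. ?L \<tau> r i"] machine_load_rank_bounds(3)[OF inst \<tau> _ i(1)]
    by fastforce
  show ?thesis
  proof (cases "k = 1")
    case True
    \<comment> \<open>With a single rank, the job that determines the makespan of \<sigma> also lies
      on some machine of \<tau>.\<close>
    have "1 \<in> {1..k}" using True by simp
    then obtain j where j: "j \<in> rank_jobs m 1" "?L \<sigma> 1 i = p j"
      using rank_job_on_machine[OF \<sigma> _ i(1)] by metis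
    have "\<tau> j \<in> machines m"
      using \<tau> j True by (auto simp: flowtime_optimal_def bij_betw_def)
    from sum_loads_le_makespan[OF inst \<tau> this]
    have "p j \<le> makespan m k p \<tau>"
      using machine_load_rank_job[OF \<tau> _ j(1)] True by simp
    then show ?thesis using i(2) j(2) True nonneg by simp
  next
    case False
    then have k2: "2 \<le> k" using k by simp
    have split: "(\<Sum>r\<in>{1..k}. f r) = f 1 + f 2 + (\<Sum>r\<in>{3..k}. f r)" for f :: "nat \<Rightarrow> real"
      using k2 sum.atLeast_Suc_atMost[of 1 k f] sum.atLeast_Suc_atMost[of 2 k f]
      by (simp add: numeral_2_eq_2 numeral_3_eq_3)
    obtain i' where i': "i' \<in> machines m" "?L \<sigma> 1 i + ?L \<sigma> 2 i \<le> ?L \<tau> 1 i' + ?L \<tau> 2 i'"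
      by (rule LD0_first_two_ranks_optimal[OF ld k2 \<tau> i(1)])
    have upper: "(\<Sum>r\<in>{3..k}. ?L \<sigma> r i) \<le> (\<Sum>r\<in>{3..k}. p ((r - 1) * m + 1))"
      by (intro sum_mono machine_load_rank_bounds(2)[OF inst \<sigma> _ i(1)]) auto
    have lower: "(\<Sum>r\<in>{3..k}. p (r * m)) \<le> (\<Sum>r\<in>{3..k}. ?L \<tau> r i')"
      by (intro sum_mono machine_load_rank_bounds(1)[OF inst \<tau> _ i'(1)]) auto
    have le: "?L \<tau> 1 i' + ?L \<tau> 2 i' + (\<Sum>r\<in>{3..k}. ?L \<tau> r i') \<le> makespan m k p \<tau>"
      using sum_loads_le_makespan[OF inst \<tau> i'(1)] by (simp only: split)
    have eq: "makespan m k p \<sigma> = ?L \<sigma> 1 i + ?L \<sigma> 2 i + (\<Sum>r\<in>{3..k}. ?L \<sigma> r i)"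
      using i(2) by (simp only: split)
    show ?thesis
    proof (cases "k = 2")
      case True
      then show ?thesis using i'(2) le eq nonneg by simp
    next
      case False
      then have k3: "3 \<le> k" using k2 by simp
      have "k * m \<in> jobs m k" using inst by (auto simp: fm_instance_def jobs_def)
      then have "0 \<le> p (k * m)" using inst by (auto simp: fm_instance_def)
      then have "(\<Sum>r\<in>{3..k}. p ((r - 1) * m + 1)) \<le> (\<Sum>r\<in>{3..k}. p (r * m)) + p (2 * m + 1)"
        using sum_first_le_sum_last[OF inst, of 3 k] k3 by simp
      \<comment> \<open>The makespan of \<sigma> exceeds that of \<tau> by at most
        \<open>p (2 * m + 1)\<close>, which is at most a third of the latter.\<close>
      then show ?thesis
        using three_times_rank3_le_makespan[OF inst \<tau> k3] i'(2) le eq upper lower by linarith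
    qed
  qed
qed

section \<open>Schedules from permutations, and the tight instance\<close>

text \<open>\<open>\<pi> r i\<close> is the machine of the \<open>i\<close>-th job of rank
  \<open>r\<close>. Jobs and ranks count from 1, hence the shifts around \<open>div\<close> and
  \<open>mod\<close>; \<open>restrict\<close> provides the extensionality that
  \<open>flowtime_optimal\<close> demands.\<close>

definition schedule_of_perms :: "nat \<Rightarrow> nat \<Rightarrow> (nat \<Rightarrow> nat \<Rightarrow> nat) \<Rightarrow> nat \<Rightarrow> nat" where
  "schedule_of_perms m k \<pi> = restrict (\<lambda>j. \<pi> ((j - 1) div m + 1) ((j - 1) mod m + 1)) (jobs m k)"

lemma rank_jobs_eq_image:
  assumes "1 \<le> r"
  shows "rank_jobs m r = (\<lambda>i. (r - 1) * m + i) ` machines m"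
  using assms by (cases r) (auto simp: rank_jobs_def machines_def)

lemma schedule_of_perms_apply:
  assumes r: "r \<in> {1..k}" and i: "i \<in> machines m"
  shows "schedule_of_perms m k \<pi> ((r - 1) * m + i) = \<pi> r i"
proof -
  have "(r - 1) * m + i \<in> jobs m k"
    using rank_jobs_subset_jobs[OF r, of m] rank_jobs_eq_image[of r m] r i by auto
  moreover have "(r - 1) * m + i - 1 = (i - 1) + (r - 1) * m" "i - 1 < m" "1 \<le> i"
    using i by (auto simp: machines_def)
  then have "((r - 1) * m + i - 1) div m + 1 = r" "((r - 1) * m + i - 1) mod m + 1 = i"
    using r by (simp_all only: div_mult_self1 mod_mult_self1 div_less mod_less) auto
  ultimately show ?thesis
    by (simp only: schedule_of_perms_def restrict_apply if_True)
qed

lemma flowtime_optimal_schedule_of_perms: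
  assumes perm: "\<And>r. r \<in> {1..k} \<Longrightarrow> bij_betw (\<pi> r) (machines m) (machines m)"
  shows "flowtime_optimal m k (schedule_of_perms m k \<pi>)"
proof -
  let ?\<sigma> = "schedule_of_perms m k \<pi>"
  have bij: "bij_betw ?\<sigma> (rank_jobs m r) (machines m)" if r: "r \<in> {1..k}" for r
  proof -
    have "bij_betw (?\<sigma> \<circ> (\<lambda>i. (r - 1) * m + i)) (machines m) (machines m)"
      using perm[OF r] schedule_of_perms_apply[OF r]
      by (subst bij_betw_cong[where g = "\<pi> r"]) auto
    moreover have "bij_betw (\<lambda>i. (r - 1) * m + i) (machines m) (rank_jobs m r)"
      using r by (auto simp: bij_betw_def rank_jobs_eq_image)
    ultimately show ?thesis using bij_betw_comp_iff by blast
  qed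
  have "?\<sigma> j \<in> machines m" if j: "j \<in> jobs m k" for j
  proof -
    have m: "0 < m" using j by (cases m) (auto simp: jobs_def)
    let ?r = "(j - 1) div m + 1"
    have "j - 1 < k * m" using j by (auto simp: jobs_def mult.commute)
    then have "?r \<in> {1..k}" by (simp add: less_mult_imp_div_less Suc_le_eq)
    moreover have "(j - 1) mod m + 1 \<in> machines m" using m by (simp add: machines_def Suc_le_eq)
    ultimately have "\<pi> ?r ((j - 1) mod m + 1) \<in> machines m"
      using perm by (auto simp: bij_betw_def)
    then show ?thesis using j by (simp add: schedule_of_perms_def)
  qed
  then show ?thesis
    using bij by (auto simp: flowtime_optimal_def schedule_of_perms_def)
qed

text \<open>Evaluating the load at \<open>\<pi> r i\<close> instead of \<open>i\<close> avoids
  inverse permutations.\<close>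

lemma machine_load_schedule_of_perms:
  assumes perm: "\<And>r. r \<in> {1..k} \<Longrightarrow> bij_betw (\<pi> r) (machines m) (machines m)"
    and r: "r \<in> {1..k}" and i: "i \<in> machines m"
  shows "machine_load p (schedule_of_perms m k \<pi>) (rank_jobs m r) (\<pi> r i) = p ((r - 1) * m + i)"
proof -
  have "(r - 1) * m + i \<in> rank_jobs m r" using r i by (auto simp: rank_jobs_eq_image)
  from machine_load_rank_job[OF flowtime_optimal_schedule_of_perms[OF perm] r this]
  show ?thesis by (simp only: schedule_of_perms_apply[OF r i])
qed

text \<open>
  The tight instance has rank 1 equal to \<open>2, 1, \<dots>, 1\<close>, rank 2 equal to \<open>1, \<dots>, 1\<close> and rank 3
  equal to \<open>1, 0, \<dots>, 0\<close>. The bad schedule puts the largest job of every rank on machine 1;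
  moving the rank-3 job of size 1 to machine 2 reduces the makespan from 4 to 3.
\<close>

lemma LD0_bound_tight:
  fixes m :: nat
  assumes m: "2 \<le> m"
  shows "\<exists>p \<sigma>. fm_instance m 3 p \<and> opt_makespan m 3 p = 3 \<and> LD0_schedule m 3 p \<sigma> \<and>
    makespan m 3 p \<sigma> = 4"
proof -
  define p :: "nat \<Rightarrow> real" where
    "p j = (if j \<le> 1 then 2 else if j \<le> 2 * m + 1 then 1 else 0)" for j
  define \<sigma> where "\<sigma> = schedule_of_perms m 3 (\<lambda>r i. i)"
  \<comment> \<open>Only rank 3 is changed, by swapping machines 1 and 2. Each
    \<open>\<pi> r\<close> is its own inverse, which gives both bijectivity and the loads of
    \<tau>.\<close>
  define \<pi> :: "nat \<Rightarrow> nat \<Rightarrow> nat" where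
    "\<pi> r i = (if r = 3 then (if i = 1 then 2 else if i = 2 then 1 else i) else i)" for r i
  define \<tau> where "\<tau> = schedule_of_perms m 3 \<pi>"
  have inst: "fm_instance m 3 p" using m by (auto simp: fm_instance_def p_def)
  have id: "bij_betw (\<lambda>i. i) (machines m) (machines m)" by (simp add: bij_betw_def)
  have perm: "bij_betw (\<pi> r) (machines m) (machines m)" for r
    using m by (intro bij_betw_byWitness[where f' = "\<pi> r"]) (auto simp: \<pi>_def machines_def)
  have \<sigma>: "flowtime_optimal m 3 \<sigma>" and \<tau>: "flowtime_optimal m 3 \<tau>"
    unfolding \<sigma>_def \<tau>_def by (rule flowtime_optimal_schedule_of_perms, rule id perm)+
  have load_\<sigma>: "machine_load p \<sigma> (rank_jobs m r) i = p ((r - 1) * m + i)"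
    if "r \<in> {1..3}" "i \<in> machines m" for r i
    unfolding \<sigma>_def using machine_load_schedule_of_perms[of 3 "\<lambda>r i. i", OF id that] .
  have load_\<tau>: "machine_load p \<tau> (rank_jobs m r) i = p ((r - 1) * m + \<pi> r i)"
    if "r \<in> {1..3}" "i \<in> machines m" for r i
  proof -
    have "\<pi> r i \<in> machines m" "\<pi> r (\<pi> r i) = i"
      using m that by (auto simp: \<pi>_def machines_def)
    then show ?thesis
      unfolding \<tau>_def using machine_load_schedule_of_perms[of 3 \<pi> m r "\<pi> r i", OF perm that(1)]
      by simp
  qed
  have ranks: "{1..3::nat} = {1, 2, 3}" by auto
  have ld: "LD0_schedule m 3 p \<sigma>"
  proof -
    \<comment> \<open>All rank-2 jobs have size 1, so any order is largest-first. Going backwards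
      sends the \<open>a\<close>-th job to machine \<open>m - a\<close>, so that machine 1, with the
      rank-1 job of size 2, is served last.\<close>
    define js where "js = rev [m + 1..<2 * m + 1]"
    have set_js: "set js = rank_jobs m 2" by (auto simp: js_def rank_jobs_def)
    have js_nth: "js ! a = m + (m - a)" if "a < m" for a
      using that by (simp add: js_def rev_nth del: upt_Suc)
    have \<sigma>2: "\<sigma> (m + i) = i" if "i \<in> machines m" for i
      using schedule_of_perms_apply[of 2 3 i m "\<lambda>r i. i"] that by (simp add: \<sigma>_def)
    have \<sigma>_nth: "\<sigma> (js ! a) = m - a" if "a < m" for a
      using \<sigma>2[of "m - a"] that by (simp only: js_nth) (auto simp: machines_def)
    have used: "\<sigma> ` set (take a js) = {m - a<..m}" if "a < m" for a
    proof -
      have "set (take a js) = (\<lambda>b. js ! b) ` {..<a}"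
        using that by (subst nth_image[symmetric]) (auto simp: js_def lessThan_atLeast0 simp del: upt_Suc)
      also have "\<sigma> ` \<dots> = (\<lambda>b. m - b) ` {..<a}"
        unfolding image_image using that \<sigma>_nth by (intro image_cong) auto
      also have "\<dots> = {m - a<..m}"
      proof (intro equalityI subsetI)
        fix i assume "i \<in> {m - a<..m}"
        then show "i \<in> (\<lambda>b. m - b) ` {..<a}"
          using that by (intro image_eqI[of _ _ "m - i"]) auto
      qed (use that in auto)
      finally show ?thesis .
    qed
    have greedy: "is_arg_min (machine_load p \<sigma> (rank_jobs m 1 \<union> set (take a js)))
        (\<lambda>i. i \<in> machines m - \<sigma> ` set (take a js)) (\<sigma> (js ! a))" if a: "a < m" for a
    proof -
      have avail: "machines m - \<sigma> ` set (take a js) = {1..m - a}"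
        using used[OF a] a by (auto simp: machines_def)
      have load: "machine_load p \<sigma> (rank_jobs m 1 \<union> set (take a js)) i = p i"
        if i: "i \<in> {1..m - a}" for i
      proof -
        have "i \<notin> \<sigma> ` set (take a js)" using i used[OF a] by auto
        then have "machine_load p \<sigma> (rank_jobs m 1 \<union> set (take a js)) i
            = machine_load p \<sigma> (rank_jobs m 1) i"
          unfolding machine_load_def by (intro sum.cong) auto
        also have "\<dots> = p i" using load_\<sigma>[of 1 i] i by (auto simp: machines_def)
        finally show ?thesis .
      qed
      \<comment> \<open>Rank-1 loads are nonincreasing in the machine index, so the available
        machine with the highest index is a correct greedy choice.\<close>
      have "p (m - a) \<le> p i" if "i \<in> {1..m - a}" for i
        using that by (auto simp: p_def)
      then show ?thesis
        using a load unfolding is_arg_min_def avail \<sigma>_nth[OF a] by (auto simp: not_less)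
    qed
    have "sorted_wrt (\<lambda>i j. p i \<ge> p j) js"
      unfolding sorted_wrt_iff_nth_less using js_nth by (auto simp: js_def p_def simp del: upt_Suc)
    moreover have "distinct js" "length js = m" by (auto simp: js_def)
    ultimately show ?thesis
      unfolding LD0_schedule_def using \<sigma> set_js greedy by blast
  qed
  have one: "1 \<in> machines m" using m by (simp add: machines_def)
  have "(\<Sum>r\<in>{1..3}. machine_load p \<sigma> (rank_jobs m r) 1) = (\<Sum>r\<in>{1..3}. p ((r - 1) * m + 1))"
    using load_\<sigma>[OF _ one] by (intro sum.cong) auto
  also have "\<dots> = 4" using m unfolding ranks by (simp add: p_def)
  finally have ge: "4 \<le> makespan m 3 p \<sigma>"
    using sum_loads_le_makespan[OF inst \<sigma> one] by simp
  obtain i where i: "i \<in> machines m"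
    "makespan m 3 p \<tau> = (\<Sum>r\<in>{1..3}. machine_load p \<tau> (rank_jobs m r) i)"
    by (rule makespan_attained[OF inst \<tau>])
  have "makespan m 3 p \<tau> = (\<Sum>r\<in>{1..3}. p ((r - 1) * m + \<pi> r i))"
    unfolding i(2) using load_\<tau>[OF _ i(1)] by (intro sum.cong) auto
  also have "\<dots> = p i + p (m + i) + p (2 * m + \<pi> 3 i)"
    unfolding ranks by (simp add: \<pi>_def)
  \<comment> \<open>Machine 1 carries 2 + 1 + 0, machine 2 carries 1 + 1 + 1, and every other
    machine 1 + 1 + 0.\<close>
  also have "\<dots> \<le> 3"
    using i(1) m by (auto simp: p_def \<pi>_def machines_def)
  finally have "opt_makespan m 3 p \<le> 3" using opt_makespan_le[OF \<tau>, of p] by linarith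
  moreover obtain \<rho> where "flowtime_optimal m 3 \<rho>" "opt_makespan m 3 p = makespan m 3 p \<rho>"
    using opt_makespan_attained[of m 3 p] m by (metis one_le_numeral order_trans)
  \<comment> \<open>Together with \<open>ge\<close> and the bound on the optimum, this squeezes 12
    between equal ends, which forces both values without examining other schedules.\<close>
  then have "3 * makespan m 3 p \<sigma> \<le> 4 * opt_makespan m 3 p"
    using LD0_makespan_bound[OF inst ld] by simp
  ultimately have "opt_makespan m 3 p = 3" "makespan m 3 p \<sigma> = 4" using ge by linarith+
  then show ?thesis using inst ld by blast
qed

theorem theorem6p6:
  "(\<forall>(m::nat) (k::nat) (p::nat \<Rightarrow> real) (\<sigma>::nat \<Rightarrow> nat).
      fm_instance m k p \<and> opt_makespan m k p > 0 \<and> LD0_schedule m k p \<sigma> \<longrightarrow>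
        1 \<le> makespan m k p \<sigma> / opt_makespan m k p \<and>
        makespan m k p \<sigma> / opt_makespan m k p \<le> 4 / 3) \<and>
   (\<forall>m::nat. m \<ge> 3 \<longrightarrow>
      (\<exists>(k::nat) (p::nat \<Rightarrow> real) (\<sigma>::nat \<Rightarrow> nat).
        fm_instance m k p \<and> opt_makespan m k p > 0 \<and> LD0_schedule m k p \<sigma> \<and>
        makespan m k p \<sigma> / opt_makespan m k p = 4 / 3))"
proof (intro conjI allI impI)
  fix m k :: nat and p :: "nat \<Rightarrow> real" and \<sigma> :: "nat \<Rightarrow> nat"
  assume *: "fm_instance m k p \<and> opt_makespan m k p > 0 \<and> LD0_schedule m k p \<sigma>"
  then have "flowtime_optimal m k \<sigma>" by (simp add: LD0_schedule_def)
  then show "1 \<le> makespan m k p \<sigma> / opt_makespan m k p"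
    using * opt_makespan_le by simp
  obtain \<tau> where "flowtime_optimal m k \<tau>" "opt_makespan m k p = makespan m k p \<tau>"
    using opt_makespan_attained[of m k p] * by (auto simp: fm_instance_def)
  then have "3 * makespan m k p \<sigma> \<le> 4 * opt_makespan m k p"
    using LD0_makespan_bound[of m k p \<sigma> \<tau>] * by simp
  then show "makespan m k p \<sigma> / opt_makespan m k p \<le> 4 / 3"
    using * by (simp add: field_simps)
next
  fix m :: nat
  assume "3 \<le> m"
  then obtain p \<sigma> where "fm_instance m 3 p" "opt_makespan m 3 p = 3" "LD0_schedule m 3 p \<sigma>"
    "makespan m 3 p \<sigma> = 4"
    using LD0_bound_tight[of m] by auto
  then show "\<exists>k p \<sigma>. fm_instance m k p \<and> opt_makespan m k p > 0 \<and> LD0_schedule m k p \<sigma> \<and>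
      makespan m k p \<sigma> / opt_makespan m k p = 4 / 3"
    by (intro exI[of _ 3] exI[of _ p] exI[of _ \<sigma>]) simp
qed

end
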